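(* In the market described in the context, the min-max least core selecting (MLC) mechanism is approximately DSIC in the following sense. Let $\bar\epsilon\in\mathbb{R}$ satisfy $\epsilon^*(\mathcal{B})\le\bar\epsilon$ for all admissible bid profiles $\mathcal{B}$. For a payment rule $p$, let the deviation bound of area $a$ when all areas are truthful be $$\beta_a(p)=\bar\epsilon+u_a^{\mathrm{VCG}}(\mathcal{V})-u_a(\mathcal{V}),$$ where $u_a^{\mathrm{VCG}}(\mathcal{V})=V(\mathcal{V})-V(\mathcal{V}_{-a})$ and $u_a(\mathcal{V})=v_a(\chi^*_{E_a}(\mathcal{V}))-p_a(\mathcal{V})$. Then, for every least core selecting payment rule $p^{\mathrm{LC}}$, $$\max_{a\in A}\beta_a(p^{\mathrm{MLC}})\le\max_{a\in A}\beta_a(p^{\mathrm{LC}}),$$ and $p^{\mathrm{MLC}}$ is itself a least core selecting payment rule; that is, the maximum over areas of the deviation bounds is minimal for the MLC mechanism among all least core selecting payment rules, under the condition that all areas are truthful.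
   Context: Market. $(A,E)$ is a finite connected simple undirected graph; $A$ is the set of areas, $E$ the set of links. For $S\subseteq A$, $E_S$ is the set of links with exactly one endpoint in $S$ (write $E_a=E_{\{a\}}$), and $E^S$ is the set of links with both endpoints in $S$. An allocation is $\chi\in[0,1]^E$; for $F\subseteq E$, $\chi_F=\{\chi_e\}_{e\in F}$. A default allocation $\chi'\in[0,1]^E$ and a set $\mathbb{S}\subseteq[0,1]^E$ with $\chi'\in\mathbb{S}$ are fixed. Each area $a$ has a true valuation $v_a:\mathbb{X}_a\to\mathbb{R}$, where $\chi'_{E_a}\in\mathbb{X}_a\subseteq[0,1]^{E_a}$ and $v_a(\chi'_{E_a})=0$. Each area submits a (possibly nontruthful) bid $b_a:\hat{\mathbb{X}}_a\to\mathbb{R}$ with $\chi'_{E_a}\in\hat{\mathbb{X}}_a\subseteq[0,1]^{E_a}$ and $b_a(\chi'_{E_a})=0$. A bid profile is $\mathcal{B}=\{b_a\}_{a\in A}$, the true profile is $\mathcal{V}=\{v_a\}_{a\in A}$; for $S\subseteq A$, $\mathcal{B}_S=\{b_a\}_{a\in S}$, and $\mathcal{B}_{-a}=\{b_j\}_{j\in A\setminus\{a\}}$, similarly $\mathcal{V}_{-a}$. Each area has a set of admissible bids containing $v_a$, a profile is admissible if every component is, and all maxima in the market problems below are assumed attained for admissible profiles. Allocation rule: $\chi^*(\mathcal{B})$ is a maximizer (selected by a fixed tie-breaking rule) of $$V(\mathcal{B})=\max_{\chi\in\mathbb{S}}\sum_{a\in A}b_a(\chi_{E_a})\ \text{ s.t.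 } \chi_{E_a}\in\hat{\mathbb{X}}_a\ \forall a\in A.$$ For $S\subseteq A$, $$V(\mathcal{B}_S)=\max_{\chi\in\mathbb{S}}\sum_{a\in S}b_a(\chi_{E_a})\ \text{ s.t. } \chi_{E_a}\in\hat{\mathbb{X}}_a\ \forall a\in S,\quad \chi_e=\chi'_e\ \forall e\in E\setminus E^S,$$ and $V(\mathcal{B}_{-a})$ is this value for $S=A\setminus\{a\}$. (When an area bids truthfully, its bid is $v_a$ with domain $\mathbb{X}_a$.) Least core. For $\epsilon\ge0$, $K_{\mathrm{Core}}(\mathcal{B},\epsilon)=\{\bar u\in\mathbb{R}^A : \sum_{a\in A}\bar u_a=V(\mathcal{B}),\ \sum_{a\in S}\bar u_a\ge V(\mathcal{B}_S)-\epsilon\ \ \forall S\subset A\}$ ($S\subset A$ proper); $\epsilon^*(\mathcal{B})=\min\{\epsilon\ge0 : K_{\mathrm{Core}}(\mathcal{B},\epsilon)\ne\emptyset\}$; the least core is $K_{\mathrm{Core}}(\mathcal{B},\epsilon^*(\mathcal{B}))$. A payment rule assigns $p_a(\mathcal{B})\in\mathbb{R}$ to each area. It is least core selecting if $p_a(\mathcal{B})=b_a(\chi^*_{E_a}(\mathcal{B}))-\bar u_a(\mathcal{B})$ for all $a$, with $\{\bar u_a(\mathcal{B})\}_{a\in A}\in K_{\mathrm{Core}}(\mathcal{B},\epsilon^*(\mathcal{B}))$ for every admissible profile $\mathcal{B}$. MLC payment rule: $p_a^{\mathrm{MLC}}(\mathcal{B})=b_a(\chi^*_{E_a}(\mathcal{B}))-\bar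 u_a^{\mathrm{MLC}}(\mathcal{B})$, where $\bar u^{\mathrm{MLC}}(\mathcal{B})$ is an optimal solution of $$\min_{\bar u}\Big\{\max_{a\in A}\ \big(\bar u_a^{\mathrm{VCG}}(\mathcal{B})-\bar u_a\big)\ :\ \bar u\in K_{\mathrm{Core}}(\mathcal{B},\epsilon^*(\mathcal{B}))\Big\},\qquad \bar u_a^{\mathrm{VCG}}(\mathcal{B})=V(\mathcal{B})-V(\mathcal{B}_{-a}).$$ *)

theory Defs
  imports Complex_Main "HOL-Library.FuncSet"
begin

text \<open>
  A link is the two-element set of its endpoints. Vectors indexed by a finite set
  \<open>F\<close> are extensional functions on \<open>F\<close>, so that the subvector \<open>\<chi>\<^sub>F\<close> is \<open>restrict \<chi> F\<close>.
  A bid is a partial function; its domain \<open>dom b\<close> is the domain of the bid.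
\<close>

type_synonym 'a alloc = "'a set \<Rightarrow> real"
type_synonym 'a bid = "'a alloc \<rightharpoonup> real"
type_synonym 'a bid_profile = "'a \<Rightarrow> 'a bid"
type_synonym 'a payment_rule = "'a bid_profile \<Rightarrow> 'a \<Rightarrow> real"

record 'a market_data =
  areas :: "'a set"
  links :: "'a set set"
  default_alloc :: "'a alloc"
  alloc_set :: "'a alloc set"
  admissible_bids :: "'a \<Rightarrow> 'a bid set"
  valuation :: "'a bid_profile"
  alloc_rule :: "'a bid_profile \<Rightarrow> 'a alloc"

definition boundary_links :: "'a market_data \<Rightarrow> 'a set \<Rightarrow> 'a set set" where
  "boundary_links M S = {e \<in> links M. card (e \<inter> S) = 1}"

definition inner_links :: "'a market_data \<Rightarrow> 'a set \<Rightarrow> 'a set set" where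
  "inner_links M S = {e \<in> links M. e \<subseteq> S}"

definition local_alloc :: "'a market_data \<Rightarrow> 'a \<Rightarrow> 'a alloc \<Rightarrow> 'a alloc" where
  "local_alloc M a \<chi> = restrict \<chi> (boundary_links M {a})"

text \<open>The condition \<open>b (local_alloc M a \<chi>') = Some 0\<close> says both that the default
  allocation lies in the domain of the bid and that its value is zero.\<close>

definition is_bid :: "'a market_data \<Rightarrow> 'a \<Rightarrow> 'a bid \<Rightarrow> bool" where
  "is_bid M a b \<longleftrightarrow>
     dom b \<subseteq> (boundary_links M {a} \<rightarrow>\<^sub>E {0..1}) \<and>
     b (local_alloc M a (default_alloc M)) = Some 0"

definition admissible_profiles :: "'a market_data \<Rightarrow> 'a bid_profile set" where
  "admissible_profiles M = (\<Pi>\<^sub>E a\<in>areas M. admissible_bids M a)"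

definition bid_value :: "'a market_data \<Rightarrow> 'a bid_profile \<Rightarrow> 'a \<Rightarrow> 'a alloc \<Rightarrow> real" where
  "bid_value M B a \<chi> = the (B a (local_alloc M a \<chi>))"

definition feasible_allocs :: "'a market_data \<Rightarrow> 'a bid_profile \<Rightarrow> 'a set \<Rightarrow> 'a alloc set" where
  "feasible_allocs M B S =
     {\<chi> \<in> alloc_set M. (\<forall>a\<in>S. local_alloc M a \<chi> \<in> dom (B a)) \<and>
        (\<forall>e \<in> links M - inner_links M S. \<chi> e = default_alloc M e)}"

definition welfare :: "'a market_data \<Rightarrow> 'a bid_profile \<Rightarrow> 'a set \<Rightarrow> 'a alloc \<Rightarrow> real" where
  "welfare M B S \<chi> = (\<Sum>a\<in>S. bid_value M B a \<chi>)"

text \<open>The supremum is a maximum in every market, by the attainment assumption of the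
  locale \<open>market\<close> below. For \<open>S = areas M\<close> no link is fixed to its default
  value (lemma \<open>feasible_allocs_areas\<close>), so \<open>coalition_value M B (areas M)\<close> is the
  value of the market problem itself.\<close>

definition coalition_value :: "'a market_data \<Rightarrow> 'a bid_profile \<Rightarrow> 'a set \<Rightarrow> real" where
  "coalition_value M B S = (SUP \<chi>\<in>feasible_allocs M B S. welfare M B S \<chi>)"

abbreviation market_value :: "'a market_data \<Rightarrow> 'a bid_profile \<Rightarrow> real" where
  "market_value M B \<equiv> coalition_value M B (areas M)"

text \<open>The tie-breaking rule is left arbitrary: \<open>alloc_rule M\<close> is any function
  selecting a maximizer for each admissible profile.\<close>

locale market =
  fixes M :: "'a market_data"
  assumes finite_areas: "finite (areas M)"
    and areas_nonempty: "areas M \<noteq> {}"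
    and links_simple: "\<And>e. e \<in> links M \<Longrightarrow> e \<subseteq> areas M \<and> card e = 2"
    and connected: "\<And>a b. a \<in> areas M \<Longrightarrow> b \<in> areas M \<Longrightarrow> (\<lambda>x y. {x, y} \<in> links M)\<^sup>*\<^sup>* a b"
    and alloc_set: "alloc_set M \<subseteq> (links M \<rightarrow>\<^sub>E {0..1})"
    and default_alloc: "default_alloc M \<in> alloc_set M"
    and admissible_bids: "\<And>a b. a \<in> areas M \<Longrightarrow> b \<in> admissible_bids M a \<Longrightarrow> is_bid M a b"
    and valuation: "valuation M \<in> admissible_profiles M"
    and maxima_attained: "\<And>B S. B \<in> admissible_profiles M \<Longrightarrow> S \<subseteq> areas M \<Longrightarrow>
          \<exists>\<chi>. is_arg_max (welfare M B S) (\<lambda>\<chi>. \<chi> \<in> feasible_allocs M B S) \<chi>"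
    and alloc_rule: "\<And>B. B \<in> admissible_profiles M \<Longrightarrow>
          is_arg_max (welfare M B (areas M)) (\<lambda>\<chi>. \<chi> \<in> feasible_allocs M B (areas M))
            (alloc_rule M B)"
begin

lemma feasible_allocs_areas:
  "feasible_allocs M B (areas M) =
     {\<chi> \<in> alloc_set M. \<forall>a\<in>areas M. local_alloc M a \<chi> \<in> dom (B a)}"
  using links_simple by (auto simp: feasible_allocs_def inner_links_def)

end

definition core :: "'a market_data \<Rightarrow> 'a bid_profile \<Rightarrow> real \<Rightarrow> ('a \<Rightarrow> real) set" where
  "core M B \<epsilon> =
     {u \<in> areas M \<rightarrow>\<^sub>E UNIV. (\<Sum>a\<in>areas M. u a) = market_value M B \<and>
        (\<forall>S. S \<subset> areas M \<longrightarrow> (\<Sum>a\<in>S. u a) \<ge> coalition_value M B S - \<epsilon>)}"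

text \<open>In a market this infimum is a minimum: the feasible pairs \<open>(\<epsilon>, u)\<close> form a
  nonempty polyhedron on which \<open>u\<close> is bounded whenever \<open>\<epsilon>\<close> is.\<close>

definition eps_star :: "'a market_data \<Rightarrow> 'a bid_profile \<Rightarrow> real" where
  "eps_star M B = Inf {\<epsilon>. 0 \<le> \<epsilon> \<and> core M B \<epsilon> \<noteq> {}}"

definition least_core :: "'a market_data \<Rightarrow> 'a bid_profile \<Rightarrow> ('a \<Rightarrow> real) set" where
  "least_core M B = core M B (eps_star M B)"

definition least_core_selecting :: "'a market_data \<Rightarrow> 'a payment_rule \<Rightarrow> bool" where
  "least_core_selecting M p \<longleftrightarrow>
     (\<exists>u. \<forall>B\<in>admissible_profiles M. u B \<in> least_core M B \<and>
        (\<forall>a\<in>areas M. p B a = bid_value M B a (alloc_rule M B) - u B a))"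

definition vcg_utility :: "'a market_data \<Rightarrow> 'a bid_profile \<Rightarrow> 'a \<Rightarrow> real" where
  "vcg_utility M B a = market_value M B - coalition_value M B (areas M - {a})"

definition mlc_solution :: "'a market_data \<Rightarrow> 'a bid_profile \<Rightarrow> ('a \<Rightarrow> real) \<Rightarrow> bool" where
  "mlc_solution M B u \<longleftrightarrow>
     is_arg_min (\<lambda>w. MAX a\<in>areas M. vcg_utility M B a - w a) (\<lambda>w. w \<in> least_core M B) u"

text \<open>The minimizer need not be unique, so this is a predicate on payment rules.\<close>

definition mlc_payment_rule :: "'a market_data \<Rightarrow> 'a payment_rule \<Rightarrow> bool" where
  "mlc_payment_rule M p \<longleftrightarrow>
     (\<exists>u. \<forall>B\<in>admissible_profiles M. mlc_solution M B (u B) \<and>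
        (\<forall>a\<in>areas M. p B a = bid_value M B a (alloc_rule M B) - u B a))"

definition truthful_utility :: "'a market_data \<Rightarrow> 'a payment_rule \<Rightarrow> 'a \<Rightarrow> real" where
  "truthful_utility M p a =
     bid_value M (valuation M) a (alloc_rule M (valuation M)) - p (valuation M) a"

definition deviation_bound :: "'a market_data \<Rightarrow> real \<Rightarrow> 'a payment_rule \<Rightarrow> 'a \<Rightarrow> real" where
  "deviation_bound M eps_bar p a =
     eps_bar + vcg_utility M (valuation M) a - truthful_utility M p a"

end

theory Submission
  imports Defs "HOL-Analysis.Function_Topology"
begin

text \<open>
  The deviation bounds are a constant plus the objective of the MLC problem at the true profile,
  so optimality is immediate. What needs proof is that the MLC problem has a solution: the pairs
  \<open>(\<epsilon>, u)\<close> with \<open>u\<close> in the \<open>\<epsilon>\<close>-core and \<open>\<epsilon>\<close> bounded form a nonempty compact set, because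
  singleton coalitions bound each \<open>u a\<close> from below and the fixed total then bounds it from
  above. Hence \<open>\<epsilon>\<close> attains its minimum, the least core is nonempty and compact, and the
  continuous objective attains its minimum there.
\<close>

lemma continuous_on_Max_image:
  fixes f :: "'a \<Rightarrow> 'b::topological_space \<Rightarrow> 'c::linorder_topology"
  assumes "finite A" "A \<noteq> {}" "\<And>a. a \<in> A \<Longrightarrow> continuous_on X (f a)"
  shows "continuous_on X (\<lambda>x. MAX a\<in>A. f a x)"
  using assms by (induction A rule: finite_ne_induct) (auto intro!: continuous_on_max)

text \<open>This is Tychonoff's theorem, adapted to extensional functions. It confines the core
  vectors to a compact set.\<close>

lemma compact_extensional_box:
  fixes l h :: "'a \<Rightarrow> real"
  shows "compact (\<Pi>\<^sub>E a\<in>A. {l a..h a})"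
proof -
  \<comment> \<open>The topology on functions is the product over the whole index type, so each
    coordinate outside \<open>A\<close> gets the compact factor \<open>{undefined}\<close>, its only
    value in an extensional function.\<close>
  define T where "T a = (if a \<in> A then {l a..h a} else {undefined})" for a
  have "(\<Pi>\<^sub>E a\<in>A. {l a..h a}) = (\<Pi>\<^sub>E a\<in>UNIV. T a)"
    by (auto simp: T_def PiE_iff extensional_def split: if_splits)
  moreover have "compact (T a)" for a
    by (simp add: T_def)
  then have "compact (\<Pi>\<^sub>E a\<in>UNIV. T a)"
    using compactin_PiE[of "\<lambda>_. euclideanreal" UNIV T]
    by (auto simp: euclidean_product_topology)
  ultimately show ?thesis by simp
qed

lemma core_mono:
  assumes "\<epsilon> \<le> \<delta>"
  shows "core M B \<epsilon> \<subseteq> core M B \<delta>"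
proof
  fix u assume u: "u \<in> core M B \<epsilon>"
  have "coalition_value M B S - \<delta> \<le> sum u S" if "S \<subset> areas M" for S
  proof -
    have "coalition_value M B S - \<epsilon> \<le> sum u S" using u that by (simp add: core_def)
    then show ?thesis using assms by linarith
  qed
  then show "u \<in> core M B \<delta>" using u by (simp add: core_def)
qed

text \<open>A singleton is a proper coalition unless \<open>a\<close> is the only area. In that case
  the equation for the total gives the bound, using \<open>0 \<le> \<epsilon>\<close>.\<close>

lemma core_lower_bound:
  assumes "u \<in> core M B \<epsilon>" "a \<in> areas M" "0 \<le> \<epsilon>"
  shows "coalition_value M B {a} - \<epsilon> \<le> u a"
proof (cases "areas M = {a}")
  case True
  then show ?thesis using assms by (simp add: core_def)
next
  case False
  then have "{a} \<subset> areas M" using assms by auto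
  then have "coalition_value M B {a} - \<epsilon> \<le> sum u {a}"
    using assms(1) unfolding core_def by blast
  then show ?thesis by simp
qed

lemma core_upper_bound:
  assumes "u \<in> core M B \<epsilon>" "a \<in> areas M" "0 \<le> \<epsilon>" "finite (areas M)"
  shows "u a \<le> market_value M B - (\<Sum>j\<in>areas M - {a}. coalition_value M B {j} - \<epsilon>)"
proof -
  have "(\<Sum>j\<in>areas M - {a}. coalition_value M B {j} - \<epsilon>) \<le> (\<Sum>j\<in>areas M - {a}. u j)"
    using assms by (intro sum_mono core_lower_bound) auto
  moreover have "market_value M B = u a + (\<Sum>j\<in>areas M - {a}. u j)"
    using assms sum.remove[of "areas M" a u] by (simp add: core_def)
  ultimately show ?thesis by simp
qed

text \<open>Any vector with the right total lies in the core once \<open>\<epsilon>\<close> covers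
  its largest shortfall over all coalitions. The equal split serves as that vector.\<close>

lemma core_nonempty_for_large_eps:
  assumes "finite (areas M)" "areas M \<noteq> {}"
  obtains \<epsilon> where "0 \<le> \<epsilon>" "core M B \<epsilon> \<noteq> {}"
proof -
  define u where "u = (\<lambda>a\<in>areas M. market_value M B / card (areas M))"
  \<comment> \<open>The inserted \<open>0\<close> makes \<open>Max D\<close> nonnegative.\<close>
  define D where "D = insert 0 ((\<lambda>S. coalition_value M B S - sum u S) ` Pow (areas M))"
  have fin: "finite D" using assms by (simp add: D_def)
  have "coalition_value M B S - sum u S \<le> Max D" if "S \<subset> areas M" for S
    using that by (intro Max_ge fin) (auto simp: D_def)
  then have "coalition_value M B S - Max D \<le> sum u S" if "S \<subset> areas M" for S
    using that by (simp add: algebra_simps)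
  moreover have "(\<Sum>a\<in>areas M. u a) = market_value M B"
    using assms by (simp add: u_def)
  ultimately have "u \<in> core M B (Max D)"
    unfolding core_def by (auto simp: u_def)
  moreover have "0 \<le> Max D" by (intro Max_ge fin) (simp add: D_def)
  ultimately show thesis using that by blast
qed

text \<open>With \<open>\<epsilon>\<close> kept as a coordinate, every core constraint is a linear
  condition on the pair \<open>(\<epsilon>, u)\<close>, hence closed. One compactness statement then
  serves both the minimum over \<open>\<epsilon>\<close> and the least core.\<close>

lemma compact_core_graph:
  assumes "finite (areas M)"
  shows "compact {(\<epsilon>, u). 0 \<le> \<epsilon> \<and> \<epsilon> \<le> c \<and> u \<in> core M B \<epsilon>}" (is "compact ?K")
proof -
  \<comment> \<open>These are the coordinate bounds at level \<open>c\<close>. They hold for all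
    \<open>\<epsilon> \<le> c\<close> because cores grow with \<open>\<epsilon>\<close>.\<close>
  define Box where "Box = (\<Pi>\<^sub>E a\<in>areas M. {coalition_value M B {a} - c ..
    market_value M B - (\<Sum>j\<in>areas M - {a}. coalition_value M B {j} - c)})"
  define F where "F = {x::real \<times> ('a \<Rightarrow> real). (\<Sum>a\<in>areas M. snd x a) = market_value M B}"
  define G where "G S = {x::real \<times> ('a \<Rightarrow> real). coalition_value M B S - fst x \<le> (\<Sum>a\<in>S. snd x a)}"
    for S
  have coord: "continuous_on UNIV (\<lambda>x::real \<times> ('a \<Rightarrow> real). snd x a)" for a
    by (rule continuous_on_product_then_coordinatewise) (intro continuous_intros)
  have closed: "closed F" "\<And>S. closed (G S)"
    unfolding F_def G_def
    by (intro closed_Collect_eq closed_Collect_le continuous_intros coord)+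
  have box: "u \<in> Box" if "0 \<le> \<epsilon>" "\<epsilon> \<le> c" "u \<in> core M B \<epsilon>" for \<epsilon> u
  proof -
    have u: "u \<in> core M B c" and c: "0 \<le> c"
      using that core_mono by (blast, linarith)
    show ?thesis unfolding Box_def
      using core_lower_bound[OF u _ c] core_upper_bound[OF u _ c assms] u
      by (auto simp: PiE_iff core_def)
  qed
  have box_ext: "u \<in> areas M \<rightarrow>\<^sub>E UNIV" if "u \<in> Box" for u
    using that by (simp add: Box_def PiE_iff)
  \<comment> \<open>\<open>H\<close> holds only the linear constraints; extensionality of
    \<open>u\<close> comes from \<open>Box\<close>.\<close>
  define H where "H = F \<inter> (\<Inter>S\<in>{S. S \<subset> areas M}. G S)"
  have H_core: "(\<epsilon>, u) \<in> H \<longleftrightarrow> u \<in> core M B \<epsilon>" if "u \<in> areas M \<rightarrow>\<^sub>E UNIV" for \<epsilon> u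
    using that by (simp add: core_def F_def G_def H_def)
  have core_ext: "u \<in> areas M \<rightarrow>\<^sub>E UNIV" if "u \<in> core M B \<epsilon>" for \<epsilon> u
    using that by (simp add: core_def)
  have "x \<in> ?K \<longleftrightarrow> x \<in> ({0..c} \<times> Box) \<inter> H" for x
  proof (cases x)
    case (Pair \<epsilon> u)
    show ?thesis
      using box[of \<epsilon> u] box_ext[of u] H_core[of u \<epsilon>] core_ext[of u \<epsilon>]
      unfolding Pair mem_Collect_eq case_prod_conv Int_iff mem_Sigma_iff atLeastAtMost_iff
      by argo
  qed
  then have "?K = ({0..c} \<times> Box) \<inter> H"
    by (rule set_eqI)
  moreover have "compact ({0..c} \<times> Box)"
    unfolding Box_def by (intro compact_Times compact_Icc compact_extensional_box)
  ultimately show ?thesis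
    using closed by (simp add: H_def compact_Int_closed closed_Int closed_INT)
qed

lemma least_core_compact:
  assumes "finite (areas M)" "0 \<le> eps_star M B"
  shows "compact (least_core M B)"
proof -
  let ?e = "eps_star M B"
  let ?K = "{(\<epsilon>, u). 0 \<le> \<epsilon> \<and> \<epsilon> \<le> ?e \<and> u \<in> core M B \<epsilon>}"
  \<comment> \<open>By monotonicity every core at a level up to \<open>?e\<close> lies in the core
    at \<open>?e\<close>, so the projection adds nothing.\<close>
  have "least_core M B = snd ` ?K"
    using assms(2) core_mono[of _ ?e M B] by (force simp: least_core_def)
  moreover have "compact (snd ` ?K)"
    by (intro compact_continuous_image continuous_intros compact_core_graph assms)
  ultimately show ?thesis by simp
qed

lemma least_core_nonempty:
  assumes "finite (areas M)" "areas M \<noteq> {}"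
  shows "0 \<le> eps_star M B" "least_core M B \<noteq> {}"
proof -
  \<comment> \<open>The level \<open>c\<close> only truncates the range of
    \<open>\<epsilon>\<close>: any level above \<open>c\<close> already exceeds the minimum found
    below it.\<close>
  obtain c where c: "0 \<le> c" "core M B c \<noteq> {}"
    using core_nonempty_for_large_eps[OF assms] .
  let ?K = "{(\<epsilon>, u). 0 \<le> \<epsilon> \<and> \<epsilon> \<le> c \<and> u \<in> core M B \<epsilon>}"
  have "compact ?K" using assms(1) by (rule compact_core_graph)
  moreover have "?K \<noteq> {}" using c by auto
  ultimately obtain x where x: "x \<in> ?K" "\<And>y. y \<in> ?K \<Longrightarrow> fst x \<le> fst y"
    using continuous_attains_inf[of ?K fst] continuous_on_fst[OF continuous_on_id] by blast
  have "fst x \<le> \<epsilon>" if "0 \<le> \<epsilon>" "core M B \<epsilon> \<noteq> {}" for \<epsilon>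
  proof (cases "\<epsilon> \<le> c")
    case True
    obtain u where "u \<in> core M B \<epsilon>" using \<open>core M B \<epsilon> \<noteq> {}\<close> by blast
    then show ?thesis using x(2)[of "(\<epsilon>, u)"] that True by simp
  next
    case False
    then show ?thesis using x(1) by auto
  qed
  \<comment> \<open>The infimum is thus attained at \<open>fst x\<close>, and \<open>snd x\<close>
    is a point of the least core.\<close>
  then have "eps_star M B = fst x"
    unfolding eps_star_def using x(1) by (intro cInf_eq_minimum) auto
  then show "0 \<le> eps_star M B" "least_core M B \<noteq> {}"
    using x(1) by (auto simp: least_core_def)
qed

lemma mlc_solution_exists:
  assumes "finite (areas M)" "areas M \<noteq> {}"
  shows "\<exists>u. mlc_solution M B u"
proof -
  have "continuous_on (least_core M B) (\<lambda>w. MAX a\<in>areas M. vcg_utility M B a - w a)"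
    by (intro continuous_on_Max_image assms continuous_intros
        continuous_on_product_then_coordinatewise)
  from continuous_attains_inf[OF least_core_compact[OF assms(1) least_core_nonempty(1)[OF assms]]
      least_core_nonempty(2)[OF assms] this]
  show ?thesis by (auto simp: mlc_solution_def is_arg_min_linorder)
qed

lemma mlc_payment_rule_exists:
  assumes "finite (areas M)" "areas M \<noteq> {}"
  shows "\<exists>p. mlc_payment_rule M p"
proof -
  \<comment> \<open>Choosing one solution for each profile \<open>B\<close> yields a single payment
    rule.\<close>
  obtain u where "\<And>B. mlc_solution M B (u B)"
    using mlc_solution_exists[OF assms] by metis
  then have "mlc_payment_rule M (\<lambda>B a. bid_value M B a (alloc_rule M B) - u B a)"
    unfolding mlc_payment_rule_def by (intro exI[of _ u]) simp
  then show ?thesis by blast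
qed

lemma mlc_payment_rule_imp_least_core_selecting:
  "mlc_payment_rule M p \<Longrightarrow> least_core_selecting M p"
  unfolding mlc_payment_rule_def least_core_selecting_def mlc_solution_def is_arg_min_def
  by blast

text \<open>The bid value cancels, so the truthful utility of \<open>a\<close> is
  \<open>u a\<close>, and the constant \<open>e\<close> moves out of the maximum.\<close>

lemma Max_deviation_bound:
  assumes "finite (areas M)" "areas M \<noteq> {}"
    and "\<And>a. a \<in> areas M \<Longrightarrow>
      p (valuation M) a = bid_value M (valuation M) a (alloc_rule M (valuation M)) - u a"
  shows "(MAX a\<in>areas M. deviation_bound M e p a)
    = (MAX a\<in>areas M. vcg_utility M (valuation M) a - u a) + e"
proof -
  have "(\<lambda>a. deviation_bound M e p a) ` areas M
      = (\<lambda>a. (vcg_utility M (valuation M) a - u a) + e) ` areas M"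
    using assms(3) by (intro image_cong) (auto simp: deviation_bound_def truthful_utility_def)
  then show ?thesis using Max_add_commute[OF assms(1,2)] by simp
qed

lemma mlc_minimizes_Max_deviation_bound:
  assumes "market M" "mlc_payment_rule M p" "least_core_selecting M q"
  shows "(MAX a\<in>areas M. deviation_bound M e p a) \<le> (MAX a\<in>areas M. deviation_bound M e q a)"
proof -
  interpret market M by fact
  obtain u where u: "mlc_solution M (valuation M) u"
    "\<And>a. a \<in> areas M \<Longrightarrow>
      p (valuation M) a = bid_value M (valuation M) a (alloc_rule M (valuation M)) - u a"
    using assms(2) valuation unfolding mlc_payment_rule_def by blast
  obtain w where w: "w \<in> least_core M (valuation M)"
    "\<And>a. a \<in> areas M \<Longrightarrow>
      q (valuation M) a = bid_value M (valuation M) a (alloc_rule M (valuation M)) - w a"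
    using assms(3) valuation unfolding least_core_selecting_def by blast
  \<comment> \<open>The vector \<open>w\<close> behind the competing rule is a feasible point of the
    problem that \<open>u\<close> solves at the true profile.\<close>
  have "(MAX a\<in>areas M. vcg_utility M (valuation M) a - u a)
      \<le> (MAX a\<in>areas M. vcg_utility M (valuation M) a - w a)"
    using u(1) w(1) by (simp add: mlc_solution_def is_arg_min_linorder)
  then show ?thesis
    using Max_deviation_bound[OF finite_areas areas_nonempty, of p u]
      Max_deviation_bound[OF finite_areas areas_nonempty, of q w] u(2) w(2) by simp
qed

theorem corollary1:
  fixes M :: "'a market_data" and eps_bar :: real
  assumes "market M"
    and "\<And>B. B \<in> admissible_profiles M \<Longrightarrow> eps_star M B \<le> eps_bar"
  shows "(\<exists>p. mlc_payment_rule M p) \<and>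
    (\<forall>p_MLC. mlc_payment_rule M p_MLC \<longrightarrow>
      least_core_selecting M p_MLC \<and>
      (\<forall>p_LC. least_core_selecting M p_LC \<longrightarrow>
        (MAX a\<in>areas M. deviation_bound M eps_bar p_MLC a)
          \<le> (MAX a\<in>areas M. deviation_bound M eps_bar p_LC a)))"
  using mlc_payment_rule_exists[OF market.finite_areas[OF assms(1)] market.areas_nonempty[OF assms(1)]]
    mlc_payment_rule_imp_least_core_selecting mlc_minimizes_Max_deviation_bound[OF assms(1)]
  by blast

end
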